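(* Let $(X,\mathcal{A},\mu)$ be a measure space with $\mu(X)>0$ such that $X$ is not an atom. Then the comaximal graph $\Gamma'_2(\mathcal{M}(X,\mathcal{A}))$ is a complete bipartite graph if and only if $X$ is partitioned into two atoms, i.e. $X=A\sqcup B$ for some atoms $A,B\in\mathcal{A}$.
   Context: $\mathcal{M}(X,\mathcal{A})$ is the commutative ring (pointwise operations) of all $\mathcal{A}$-measurable functions $f:X\to\mathbb{R}$; $Z(f)=\{x\in X:f(x)=0\}$. A set $A\in\mathcal{A}$ is an atom if $\mu(A)>0$ and $A$ cannot be written as $A=B\sqcup C$ (disjoint union) with $B,C\in\mathcal{A}$, $\mu(B)>0$, $\mu(C)>0$. A function $u\in\mathcal{M}(X,\mathcal{A})$ is a $\mu$-unit if $\mu(Z(u))=0$. Write $\mathscr{D}=\{f\in\mathcal{M}(X,\mathcal{A}):\mu(Z(f))>0\text{ and }\mu(X\setminus Z(f))>0\}$, i.e. the functions that are neither $\mu$-units nor equal to $0$ almost everywhere. The comaximal graph $\Gamma'_2(\mathcal{M}(X,\mathcal{A}))$ is the simple graph with vertex set $\mathscr{D}$ in which distinct $f,g$ are adjacent iff the sum of principal ideals $\langle f\rangle+\langle g\rangle$ equals $\langle u\rangle$ for some $\mu$-unit $u$. A graph is complete bipartite if its vertex set is a disjoint union of two (nonempty) stable sets (sets with no two adjacent vertices) such that any two vertices from different sets are adjacent. *)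

theory Defs
  imports "HOL-Analysis.Analysis" "HOL-Algebra.Ideal" "Graph_Theory.Pair_Digraph"
begin

text \<open>Functions on \<open>X = space M\<close> are taken extensional (\<open>undefined\<close> off \<open>X\<close>), so that equality in
  the carrier is equality of functions \<open>X \<rightarrow> \<real>\<close>.\<close>

definition measurable_ring :: "'a measure \<Rightarrow> ('a \<Rightarrow> real) ring" where
  "measurable_ring M =
     \<lparr> carrier = borel_measurable M \<inter> extensional (space M),
       mult = (\<lambda>f g. \<lambda>x\<in>space M. f x * g x),
       one = (\<lambda>x\<in>space M. 1),
       zero = (\<lambda>x\<in>space M. 0),
       add = (\<lambda>f g. \<lambda>x\<in>space M. f x + g x) \<rparr>"

lemma measurable_ring_sel:
  "carrier (measurable_ring M) = borel_measurable M \<inter> extensional (space M)"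
  "mult (measurable_ring M) f g = (\<lambda>x\<in>space M. f x * g x)"
  "one (measurable_ring M) = (\<lambda>x\<in>space M. 1)"
  "zero (measurable_ring M) = (\<lambda>x\<in>space M. 0)"
  "add (measurable_ring M) f g = (\<lambda>x\<in>space M. f x + g x)"
  by (simp_all add: measurable_ring_def)

lemma measurable_ring_restrict:
  assumes "f \<in> borel_measurable M"
  shows "restrict f (space M) \<in> carrier (measurable_ring M)"
proof -
  have "restrict f (space M) \<in> borel_measurable M \<longleftrightarrow> f \<in> borel_measurable M"
    by (rule measurable_cong) simp
  then show ?thesis
    using assms by (simp add: measurable_ring_sel)
qed

lemma measurable_ring_cring: "cring (measurable_ring M)"
proof (rule cringI)
  note eqI = extensionalityI[where A = "space M"]
  have meas: "f \<in> borel_measurable M" and ext: "f \<in> extensional (space M)"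
    if "f \<in> carrier (measurable_ring M)" for f
    using that by (simp_all add: measurable_ring_sel)
  have add: "add (measurable_ring M) f g \<in> carrier (measurable_ring M)"
    and mult: "mult (measurable_ring M) f g \<in> carrier (measurable_ring M)"
    if "f \<in> carrier (measurable_ring M)" "g \<in> carrier (measurable_ring M)" for f g
    using meas[OF that(1)] meas[OF that(2)]
    by (simp_all add: measurable_ring_sel(2,5) measurable_ring_restrict)
  have zero: "zero (measurable_ring M) \<in> carrier (measurable_ring M)"
    and one: "one (measurable_ring M) \<in> carrier (measurable_ring M)"
    by (simp_all add: measurable_ring_sel(3,4) measurable_ring_restrict)
  have neg: "\<exists>g\<in>carrier (measurable_ring M).
      add (measurable_ring M) g f = zero (measurable_ring M)"
    if "f \<in> carrier (measurable_ring M)" for f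
    using meas[OF that]
    by (intro bexI[of _ "\<lambda>x\<in>space M. - f x"] measurable_ring_restrict)
      (auto simp: measurable_ring_sel intro: restrict_ext)
  show "abelian_group (measurable_ring M)"
    by (rule abelian_groupI)
      (assumption | rule add zero neg |
        force simp: measurable_ring_sel(2-) add_ac intro!: eqI restrict_ext dest: ext)+
  show "Group.comm_monoid (measurable_ring M)"
    by (rule comm_monoidI)
      (assumption | rule mult one |
        force simp: measurable_ring_sel(2-) mult_ac intro!: eqI restrict_ext dest: ext)+
qed (auto simp: measurable_ring_sel(2-) distrib_right intro!: restrict_ext)

definition zero_set :: "'a measure \<Rightarrow> ('a \<Rightarrow> real) \<Rightarrow> 'a set" where
  "zero_set M f = {x \<in> space M. f x = 0}"

definition atom :: "'a measure \<Rightarrow> 'a set \<Rightarrow> bool" where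
  "atom M A \<longleftrightarrow> A \<in> sets M \<and> emeasure M A > 0 \<and>
     \<not> (\<exists>B C. B \<in> sets M \<and> C \<in> sets M \<and> A = B \<union> C \<and> B \<inter> C = {} \<and>
            emeasure M B > 0 \<and> emeasure M C > 0)"

definition mu_unit :: "'a measure \<Rightarrow> ('a \<Rightarrow> real) \<Rightarrow> bool" where
  "mu_unit M u \<longleftrightarrow> u \<in> carrier (measurable_ring M) \<and> emeasure M (zero_set M u) = 0"

definition comaximal_vertices :: "'a measure \<Rightarrow> ('a \<Rightarrow> real) set" where
  "comaximal_vertices M = {f \<in> carrier (measurable_ring M).
     emeasure M (zero_set M f) > 0 \<and> emeasure M (space M - zero_set M f) > 0}"

definition comaximal_graph :: "'a measure \<Rightarrow> ('a \<Rightarrow> real) pair_pre_digraph" where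
  "comaximal_graph M =
     \<lparr> pverts = comaximal_vertices M,
       parcs = {(f, g). f \<in> comaximal_vertices M \<and> g \<in> comaximal_vertices M \<and> f \<noteq> g \<and>
         (\<exists>u. mu_unit M u \<and>
            PIdl\<^bsub>measurable_ring M\<^esub> f <+>\<^bsub>measurable_ring M\<^esub> PIdl\<^bsub>measurable_ring M\<^esub> g =
            PIdl\<^bsub>measurable_ring M\<^esub> u)} \<rparr>"

text \<open>A simple graph is represented by a symmetric loop-free arc relation; the locale
  \<open>pair_graph\<close> is not usable since it also demands finiteness.\<close>

lemma comaximal_graph_simple:
  "pair_sym_digraph (comaximal_graph M)" "pair_loopfree_digraph (comaximal_graph M)"
proof -
  interpret cring "measurable_ring M" by (rule measurable_ring_cring)
  have carr: "PIdl\<^bsub>measurable_ring M\<^esub> h \<subseteq> carrier (measurable_ring M)"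
    if "h \<in> comaximal_vertices M" for h
    using that cgenideal_ideal[of h] by (auto simp: comaximal_vertices_def intro: ideal.Icarr)
  have sub: "H <+>\<^bsub>measurable_ring M\<^esub> K \<subseteq> K <+>\<^bsub>measurable_ring M\<^esub> H"
    if "H \<subseteq> carrier (measurable_ring M)" "K \<subseteq> carrier (measurable_ring M)" for H K
  proof
    fix x assume "x \<in> H <+>\<^bsub>measurable_ring M\<^esub> K"
    then obtain h k where hk: "h \<in> H" "k \<in> K" "x = h \<oplus>\<^bsub>measurable_ring M\<^esub> k"
      by (auto simp: set_add_def')
    then have "x = k \<oplus>\<^bsub>measurable_ring M\<^esub> h"
      using a_comm[of h k] that by blast
    then show "x \<in> K <+>\<^bsub>measurable_ring M\<^esub> H"
      using hk(1,2) unfolding set_add_def' by blast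
  qed
  have comm: "PIdl\<^bsub>measurable_ring M\<^esub> f <+>\<^bsub>measurable_ring M\<^esub> PIdl\<^bsub>measurable_ring M\<^esub> g =
      PIdl\<^bsub>measurable_ring M\<^esub> g <+>\<^bsub>measurable_ring M\<^esub> PIdl\<^bsub>measurable_ring M\<^esub> f"
    if "f \<in> comaximal_vertices M" "g \<in> comaximal_vertices M" for f g
    by (intro subset_antisym sub carr that)
  show "pair_sym_digraph (comaximal_graph M)"
  proof
    show "Digraph.symmetric (with_proj (comaximal_graph M))"
      unfolding symmetric_conv by (auto simp: comaximal_graph_def) (metis comm)
  qed (auto simp: comaximal_graph_def)
  show "pair_loopfree_digraph (comaximal_graph M)"
    by standard (auto simp: comaximal_graph_def)
qed

definition stable_set :: "'v pair_pre_digraph \<Rightarrow> 'v set \<Rightarrow> bool" where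
  "stable_set G S \<longleftrightarrow> S \<subseteq> pverts G \<and> (\<forall>u\<in>S. \<forall>v\<in>S. (u, v) \<notin> parcs G)"

text \<open>Intended for symmetric \<open>G\<close>, where it suffices to ask for the arcs in one direction.\<close>

definition complete_bipartite :: "'v pair_pre_digraph \<Rightarrow> bool" where
  "complete_bipartite G \<longleftrightarrow>
     (\<exists>U V. U \<noteq> {} \<and> V \<noteq> {} \<and> U \<inter> V = {} \<and> pverts G = U \<union> V \<and>
            stable_set G U \<and> stable_set G V \<and> (\<forall>u\<in>U. \<forall>v\<in>V. (u, v) \<in> parcs G))"

end

theory Submission
  imports Defs
begin

text \<open>Two vertices are adjacent iff their zero sets meet in a null set, because
  \<open>\<langle>f\<rangle> + \<langle>g\<rangle> = \<langle>f\<^sup>2 + g\<^sup>2\<rangle>\<close>. If \<open>X\<close> is split into three sets of positive measure, the functions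
  vanishing exactly on these sets form a triangle, so in a bipartite graph both pieces of a splitting
  of \<open>X\<close> are atoms. Conversely, if \<open>X = A \<squnion> B\<close> with atoms \<open>A\<close> and \<open>B\<close>, the zero set of a vertex is,
  up to a null set, one of \<open>A\<close> and \<open>B\<close>, and this gives the two parts.\<close>

section \<open>Adjacency in terms of zero sets\<close>

lemma zero_set_sets [measurable]:
  assumes "f \<in> carrier (measurable_ring M)"
  shows "zero_set M f \<in> sets M"
proof -
  have [measurable]: "f \<in> borel_measurable M"
    using assms by (simp add: measurable_ring_sel)
  show ?thesis
    unfolding zero_set_def by measurable
qed

text \<open>Real squares cannot cancel, so the sum of squares vanishes only at common zeros of
  \<open>f\<close> and \<open>g\<close>; dividing by it exhibits both as its multiples.\<close>

lemma principal_ideals_sum_eq_sum_squares: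
  fixes M :: "'a measure"
  defines "R \<equiv> measurable_ring M"
  assumes f: "f \<in> carrier R" and g: "g \<in> carrier R"
  shows "PIdl\<^bsub>R\<^esub> f <+>\<^bsub>R\<^esub> PIdl\<^bsub>R\<^esub> g = PIdl\<^bsub>R\<^esub> (f \<otimes>\<^bsub>R\<^esub> f \<oplus>\<^bsub>R\<^esub> g \<otimes>\<^bsub>R\<^esub> g)"
    (is "?S = PIdl\<^bsub>R\<^esub> ?u")
proof
  interpret cring R
    unfolding R_def by (rule measurable_ring_cring)
  have u: "?u \<in> carrier R"
    using f g by simp
  interpret S: ideal ?S R
    by (intro add_ideals cgenideal_ideal f g)
  have "?u \<in> ?S"
    using f g unfolding set_add_def' cgenideal_def by blast
  then show "PIdl\<^bsub>R\<^esub> ?u \<subseteq> ?S"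
    by (rule cgenideal_minimal[OF S.is_ideal])
  interpret U: ideal "PIdl\<^bsub>R\<^esub> ?u" R
    by (rule cgenideal_ideal[OF u])
  have [measurable]: "f \<in> borel_measurable M" "g \<in> borel_measurable M"
    using f g by (simp_all add: R_def measurable_ring_sel)
  \<comment> \<open>The quotient is 0 at common zeros of \<open>f\<close> and \<open>g\<close>, where \<open>h\<close> vanishes too.\<close>
  have mem: "h \<in> PIdl\<^bsub>R\<^esub> ?u"
    if h: "h \<in> carrier R" and "h = f \<or> h = g" for h
  proof -
    define q where "q = (\<lambda>x\<in>space M. h x / (f x * f x + g x * g x))"
    have [measurable]: "h \<in> borel_measurable M"
      using h by (simp add: R_def measurable_ring_sel)
    have "q \<in> carrier R"
      unfolding q_def R_def by (rule measurable_ring_restrict) measurable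
    moreover have "h = q \<otimes>\<^bsub>R\<^esub> ?u"
    proof (rule extensionalityI[where A = "space M"])
      show "h \<in> extensional (space M)"
        using h by (simp add: R_def measurable_ring_sel)
      show "h x = (q \<otimes>\<^bsub>R\<^esub> ?u) x" if "x \<in> space M" for x
        using that \<open>h = f \<or> h = g\<close> sum_squares_eq_zero_iff[of "f x" "g x"]
        by (auto simp: q_def R_def measurable_ring_sel)
    qed (simp add: R_def measurable_ring_sel)
    ultimately show ?thesis
      unfolding cgenideal_def by blast
  qed
  show "?S \<subseteq> PIdl\<^bsub>R\<^esub> ?u"
  proof
    fix x assume "x \<in> ?S"
    then obtain a b where "a \<in> carrier R" "b \<in> carrier R" "x = a \<otimes>\<^bsub>R\<^esub> f \<oplus>\<^bsub>R\<^esub> b \<otimes>\<^bsub>R\<^esub> g"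
      unfolding set_add_def' cgenideal_def by blast
    then show "x \<in> PIdl\<^bsub>R\<^esub> ?u"
      using mem f g by (simp add: U.I_l_closed)
  qed
qed

text \<open>Every element of the ideal sum vanishes at the common zeros of \<open>f\<close> and
  \<open>g\<close>, so a \<mu>-unit in it forces these to be null. Conversely, the common zeros are
  exactly the zeros of the generator \<open>f^2 + g^2\<close>.\<close>

lemma comaximal_iff_null_common_zeros:
  fixes M :: "'a measure"
  defines "R \<equiv> measurable_ring M"
  assumes f: "f \<in> carrier R" and g: "g \<in> carrier R"
  shows "(\<exists>u. mu_unit M u \<and> PIdl\<^bsub>R\<^esub> f <+>\<^bsub>R\<^esub> PIdl\<^bsub>R\<^esub> g = PIdl\<^bsub>R\<^esub> u) \<longleftrightarrow>
    emeasure M (zero_set M f \<inter> zero_set M g) = 0"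
proof
  interpret cring R
    unfolding R_def by (rule measurable_ring_cring)
  assume "\<exists>u. mu_unit M u \<and> PIdl\<^bsub>R\<^esub> f <+>\<^bsub>R\<^esub> PIdl\<^bsub>R\<^esub> g = PIdl\<^bsub>R\<^esub> u"
  then obtain u where u: "u \<in> carrier R" "emeasure M (zero_set M u) = 0"
    and eq: "PIdl\<^bsub>R\<^esub> f <+>\<^bsub>R\<^esub> PIdl\<^bsub>R\<^esub> g = PIdl\<^bsub>R\<^esub> u"
    unfolding mu_unit_def R_def by blast
  have "u \<in> PIdl\<^bsub>R\<^esub> f <+>\<^bsub>R\<^esub> PIdl\<^bsub>R\<^esub> g"
    unfolding eq using u(1) by (rule cgenideal_self)
  then obtain a b where "u = a \<otimes>\<^bsub>R\<^esub> f \<oplus>\<^bsub>R\<^esub> b \<otimes>\<^bsub>R\<^esub> g"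
    unfolding set_add_def' cgenideal_def by blast
  then have "zero_set M f \<inter> zero_set M g \<subseteq> zero_set M u"
    by (auto simp: zero_set_def R_def measurable_ring_sel)
  from emeasure_mono[OF this, of M] show "emeasure M (zero_set M f \<inter> zero_set M g) = 0"
    using u by (simp add: R_def zero_set_sets)
next
  interpret cring R
    unfolding R_def by (rule measurable_ring_cring)
  let ?u = "f \<otimes>\<^bsub>R\<^esub> f \<oplus>\<^bsub>R\<^esub> g \<otimes>\<^bsub>R\<^esub> g"
  assume null: "emeasure M (zero_set M f \<inter> zero_set M g) = 0"
  have "?u \<in> carrier R"
    using f g by simp
  moreover have "zero_set M ?u = zero_set M f \<inter> zero_set M g"
    by (auto simp: zero_set_def R_def measurable_ring_sel sum_squares_eq_zero_iff)
  ultimately have "mu_unit M ?u"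
    using null by (simp add: mu_unit_def R_def)
  then show "\<exists>u. mu_unit M u \<and> PIdl\<^bsub>R\<^esub> f <+>\<^bsub>R\<^esub> PIdl\<^bsub>R\<^esub> g = PIdl\<^bsub>R\<^esub> u"
    using principal_ideals_sum_eq_sum_squares[of f M g] f g unfolding R_def by blast
qed

lemma pverts_comaximal_graph: "pverts (comaximal_graph M) = comaximal_vertices M"
  by (simp add: comaximal_graph_def)

lemma parcs_comaximal_graph_iff:
  "(f, g) \<in> parcs (comaximal_graph M) \<longleftrightarrow>
    f \<in> comaximal_vertices M \<and> g \<in> comaximal_vertices M \<and>
    emeasure M (zero_set M f \<inter> zero_set M g) = 0"
proof (cases "f \<in> comaximal_vertices M \<and> g \<in> comaximal_vertices M")
  case True
  \<comment> \<open>For \<open>f = g\<close> the intersection is \<open>zero_set M f\<close>, which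
    has positive measure for a vertex; so a null intersection yields distinctness.\<close>
  then have "emeasure M (zero_set M f \<inter> zero_set M g) = 0 \<Longrightarrow> f \<noteq> g"
    by (auto simp: comaximal_vertices_def)
  with True show ?thesis
    using comaximal_iff_null_common_zeros[of f M g]
    by (auto simp: comaximal_graph_def comaximal_vertices_def)
qed (auto simp: comaximal_graph_def)

section \<open>Realizing zero sets, and splitting atoms\<close>

lemma obtain_vertex_with_zero_set:
  assumes S: "S \<in> sets M" "emeasure M S > 0" "emeasure M (space M - S) > 0"
  obtains f where "f \<in> comaximal_vertices M" "zero_set M f = S"
proof -
  \<comment> \<open>The indicator of the complement vanishes exactly on \<open>S\<close>;
    restricting it gives the extensional representative.\<close>
  let ?f = "restrict (indicat_real (space M - S)) (space M)"
  have "zero_set M ?f = S"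
    using sets.sets_into_space[OF S(1)] by (auto simp: zero_set_def indicator_def)
  moreover have "?f \<in> carrier (measurable_ring M)"
    using S(1) by (intro measurable_ring_restrict borel_measurable_indicator) auto
  ultimately show thesis
    using S that[of ?f] by (simp add: comaximal_vertices_def)
qed

text \<open>\<open>S\<close> cuts \<open>A\<close> into \<open>S \<inter> A\<close> and
  \<open>A - S\<close>, and the two pieces of an atom cannot both have positive measure.\<close>

lemma atom_cases:
  assumes "atom M A" "S \<in> sets M"
  shows "emeasure M (S \<inter> A) = 0 \<or> emeasure M (A - S) = 0"
proof (rule ccontr)
  assume *: "\<not> ?thesis"
  have "A \<in> sets M"
    using assms(1) by (simp add: atom_def)
  then have "S \<inter> A \<in> sets M" "A - S \<in> sets M"
    using assms(2) by auto
  moreover have "A = (S \<inter> A) \<union> (A - S)" "(S \<inter> A) \<inter> (A - S) = {}"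
    by auto
  moreover have "emeasure M (S \<inter> A) > 0" "emeasure M (A - S) > 0"
    using * by (auto simp: zero_less_iff_neq_zero)
  ultimately show False
    using assms(1) unfolding atom_def by blast
qed

section \<open>From a bipartite graph to two atoms\<close>

lemma bipartite_no_positive_triple:
  assumes bip: "complete_bipartite (comaximal_graph M)"
    and sets: "P \<in> sets M" "Q \<in> sets M" "T \<in> sets M"
    and pos: "emeasure M P > 0" "emeasure M Q > 0" "emeasure M T > 0"
    and disj: "P \<inter> Q = {}" "Q \<inter> T = {}" "P \<inter> T = {}"
  shows False
proof -
  \<comment> \<open>Another of the three disjoint sets lies in the complement of \<open>S\<close>,
    so a function vanishing exactly on \<open>S\<close> is a vertex.\<close>
  have compl: "emeasure M (space M - S) > 0"
    if "S' \<in> sets M" "S \<in> sets M" "emeasure M S' > 0" "S \<inter> S' = {}" for S S'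
  proof -
    have "S' \<subseteq> space M - S"
      using that sets.sets_into_space by blast
    from emeasure_mono[OF this] show ?thesis
      using that by (auto intro: less_le_trans)
  qed
  obtain p where p: "p \<in> comaximal_vertices M" "zero_set M p = P"
    using obtain_vertex_with_zero_set[of P M] compl[of Q P] sets pos disj by blast
  obtain q where q: "q \<in> comaximal_vertices M" "zero_set M q = Q"
    using obtain_vertex_with_zero_set[of Q M] compl[of T Q] sets pos disj by blast
  obtain t where t: "t \<in> comaximal_vertices M" "zero_set M t = T"
    using obtain_vertex_with_zero_set[of T M] compl[of P T] sets pos disj by blast
  have arcs: "(p, q) \<in> parcs (comaximal_graph M)" "(q, t) \<in> parcs (comaximal_graph M)"
    "(p, t) \<in> parcs (comaximal_graph M)"
    using p q t disj by (simp_all add: parcs_comaximal_graph_iff)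
  obtain U V where UV: "comaximal_vertices M = U \<union> V"
    "stable_set (comaximal_graph M) U" "stable_set (comaximal_graph M) V"
    using bip by (auto simp: complete_bipartite_def pverts_comaximal_graph)
  have "p \<in> U \<or> p \<in> V" "q \<in> U \<or> q \<in> V" "t \<in> U \<or> t \<in> V"
    using UV(1) p(1) q(1) t(1) by auto
  moreover have no_arc: "\<not> (x \<in> S \<and> y \<in> S)"
    if "(x, y) \<in> parcs (comaximal_graph M)" "S = U \<or> S = V" for x y S
    using UV(2,3) that unfolding stable_set_def by blast
  \<comment> \<open>By pigeonhole, two of the three pairwise adjacent vertices lie in the same
    stable set.\<close>
  ultimately show False
    using no_arc[OF arcs(1)] no_arc[OF arcs(2)] no_arc[OF arcs(3)] by metis
qed

text \<open>The set \<open>B\<close> serves as the third member of the forbidden triple: a splitting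
  of \<open>A\<close> would supply the other two.\<close>

lemma bipartite_imp_atom:
  assumes "complete_bipartite (comaximal_graph M)"
    and "A \<in> sets M" "B \<in> sets M" "A \<inter> B = {}" "emeasure M A > 0" "emeasure M B > 0"
  shows "atom M A"
  unfolding atom_def
proof (intro conjI notI)
  assume "\<exists>P Q. P \<in> sets M \<and> Q \<in> sets M \<and> A = P \<union> Q \<and> P \<inter> Q = {} \<and>
    emeasure M P > 0 \<and> emeasure M Q > 0"
  then obtain P Q where "P \<in> sets M" "Q \<in> sets M" "A = P \<union> Q" "P \<inter> Q = {}"
    "emeasure M P > 0" "emeasure M Q > 0"
    by blast
  with assms show False
    using bipartite_no_positive_triple[of M P Q B] by blast
qed (use assms in auto)

section \<open>From two atoms to a complete bipartite graph\<close>

lemma two_atoms_imp_complete_bipartite: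
  assumes A: "atom M A" and B: "atom M B" and AB: "A \<union> B = space M" "A \<inter> B = {}"
  shows "complete_bipartite (comaximal_graph M)"
proof -
  let ?W = "comaximal_vertices M"
  \<comment> \<open>A vertex is sorted by the atom its zero set almost misses, so
    \<open>part A\<close> holds those vanishing almost everywhere on \<open>B\<close>.\<close>
  define part where "part C = {f \<in> ?W. emeasure M (zero_set M f \<inter> C) = 0}" for C
  have sets [measurable]: "A \<in> sets M" "B \<in> sets M"
    and pos: "emeasure M A > 0" "emeasure M B > 0"
    using A B by (auto simp: atom_def)
  have Z: "zero_set M f \<in> sets M" if "f \<in> ?W" for f
    using that by (simp add: comaximal_vertices_def zero_set_sets)
  have null_split: "emeasure M S = 0"
    if "S \<in> sets M" "emeasure M (S \<inter> A) = 0" "emeasure M (S \<inter> B) = 0" for S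
  proof -
    have "S = (S \<inter> A) \<union> (S \<inter> B)"
      using AB sets.sets_into_space[OF that(1)] by blast
    moreover have "(S \<inter> A) \<union> (S \<inter> B) \<in> null_sets M"
      using that sets by (intro null_sets.Un) auto
    ultimately show ?thesis
      by auto
  qed
  have not_both: "\<not> (emeasure M (zero_set M f \<inter> A) = 0 \<and> emeasure M (zero_set M f \<inter> B) = 0)"
    if "f \<in> ?W" for f
    using that null_split[OF Z[OF that]] by (auto simp: comaximal_vertices_def)
  \<comment> \<open>If the zero set met both atoms in positive measure, it would fill both up to
    null sets, and the vertex would be 0 almost everywhere.\<close>
  have one: "emeasure M (zero_set M f \<inter> A) = 0 \<or> emeasure M (zero_set M f \<inter> B) = 0"
    if "f \<in> ?W" for f
  proof (rule ccontr)
    assume "\<not> ?thesis"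
    then have null: "emeasure M (A - zero_set M f) = 0" "emeasure M (B - zero_set M f) = 0"
      using atom_cases[OF A Z[OF that]] atom_cases[OF B Z[OF that]] by blast+
    have inter: "(space M - zero_set M f) \<inter> A = A - zero_set M f"
      "(space M - zero_set M f) \<inter> B = B - zero_set M f"
      using AB by auto
    have "emeasure M ((space M - zero_set M f) \<inter> A) = 0"
      "emeasure M ((space M - zero_set M f) \<inter> B) = 0"
      by (simp_all only: inter null)
    then have "emeasure M (space M - zero_set M f) = 0"
      by (rule null_split[OF sets.compl_sets[OF Z[OF that]]])
    with that show False
      by (simp add: comaximal_vertices_def)
  qed
  \<comment> \<open>Here \<open>D\<close> is the atom other than \<open>C\<close>. The zero sets of
    two vertices in \<open>part C\<close> both contain \<open>D\<close> up to null sets, hence so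
    does their intersection.\<close>
  have stable: "stable_set (comaximal_graph M) (part C)"
    if D: "atom M D" and CD: "C = A \<and> D = B \<or> C = B \<and> D = A" for C D
  proof -
    have D_sets: "D \<in> sets M" "emeasure M D > 0"
      using D by (auto simp: atom_def)
    have D_null: "D - zero_set M f \<in> null_sets M" if "f \<in> part C" for f
    proof -
      have "f \<in> ?W" "emeasure M (zero_set M f \<inter> D) \<noteq> 0"
        using that CD not_both[of f] by (auto simp: part_def)
      then show ?thesis
        using atom_cases[OF D Z] D_sets Z by auto
    qed
    have "emeasure M (zero_set M f \<inter> zero_set M g) \<noteq> 0" if fg: "f \<in> part C" "g \<in> part C" for f g
    proof
      assume "emeasure M (zero_set M f \<inter> zero_set M g) = 0"
      then have "zero_set M f \<inter> zero_set M g \<in> null_sets M"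
        using fg Z by (auto simp: part_def)
      then have "(zero_set M f \<inter> zero_set M g) \<union> (D - zero_set M f) \<union> (D - zero_set M g) \<in> null_sets M"
        using fg D_null by (intro null_sets.Un) auto
      then have "D \<in> null_sets M"
        using D_sets(1) by (rule null_sets_subset) auto
      with D_sets(2) show False
        by auto
    qed
    then show ?thesis
      by (auto simp: stable_set_def parcs_comaximal_graph_iff pverts_comaximal_graph part_def)
  qed
  have compl: "space M - A = B" "space M - B = A"
    using AB by auto
  obtain a b where ab: "a \<in> ?W" "zero_set M a = A" "b \<in> ?W" "zero_set M b = B"
    using obtain_vertex_with_zero_set[of A M] obtain_vertex_with_zero_set[of B M] sets pos compl
    by metis
  \<comment> \<open>The common zeros meet \<open>A\<close> in a null set because of
    \<open>f\<close>, and \<open>B\<close> because of \<open>g\<close>.\<close>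
  have cross: "(f, g) \<in> parcs (comaximal_graph M)" if fg: "f \<in> part A" "g \<in> part B" for f g
  proof -
    have W: "f \<in> ?W" "g \<in> ?W"
      and null: "emeasure M (zero_set M f \<inter> A) = 0" "emeasure M (zero_set M g \<inter> B) = 0"
      using fg by (auto simp: part_def)
    have "emeasure M (zero_set M f \<inter> zero_set M g \<inter> A) \<le> emeasure M (zero_set M f \<inter> A)"
      "emeasure M (zero_set M f \<inter> zero_set M g \<inter> B) \<le> emeasure M (zero_set M g \<inter> B)"
      using W Z by (intro emeasure_mono; auto)+
    then have "emeasure M (zero_set M f \<inter> zero_set M g) = 0"
      using null_split[of "zero_set M f \<inter> zero_set M g"] W Z null by auto
    with W show ?thesis
      by (simp add: parcs_comaximal_graph_iff)
  qed
  \<comment> \<open>The indices cross: \<open>b\<close> vanishes exactly on \<open>B\<close>, so its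
    zero set misses \<open>A\<close>. This makes both parts nonempty.\<close>
  have "b \<in> part A" "a \<in> part B"
    using ab AB(2) by (auto simp: part_def Int_commute)
  moreover have "part A \<inter> part B = {}" "?W = part A \<union> part B"
    using not_both one by (auto simp: part_def)
  ultimately show ?thesis
    unfolding complete_bipartite_def pverts_comaximal_graph
    using stable[OF A] stable[OF B] cross
    by (intro exI[of _ "part A"] exI[of _ "part B"]) auto
qed

theorem theorem3p10:
  fixes M :: "'a measure"
  assumes "emeasure M (space M) > 0"
    and "\<not> atom M (space M)"
  shows "complete_bipartite (comaximal_graph M) \<longleftrightarrow>
    (\<exists>A B. atom M A \<and> atom M B \<and> A \<union> B = space M \<and> A \<inter> B = {})"
proof
  assume bip: "complete_bipartite (comaximal_graph M)"
  \<comment> \<open>As \<open>space M\<close> has positive measure, it can fail to be an atom only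
    by splitting into two sets of positive measure.\<close>
  obtain A B where AB: "A \<in> sets M" "B \<in> sets M" "space M = A \<union> B" "A \<inter> B = {}"
    "emeasure M A > 0" "emeasure M B > 0"
    using assms unfolding atom_def by blast
  have "atom M A" "atom M B"
    using bipartite_imp_atom[OF bip, of A B] bipartite_imp_atom[OF bip, of B A] AB by auto
  with AB show "\<exists>A B. atom M A \<and> atom M B \<and> A \<union> B = space M \<and> A \<inter> B = {}"
    by blast
qed (use two_atoms_imp_complete_bipartite in blast)

end
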